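(* Let $n\ge 2$, let $\mathcal{N}\subseteq\mathbb{R}^n$ be a neighborhood containing a point $\mathbf{p}$, and let $f:\mathcal{N}\to\mathbb{R}$ and $g:\mathcal{N}\to\mathbb{R}$ be differentiable functions with $f(\mathbf{p})=g(\mathbf{p})=0$. Set $$C=\{\mathbf{x}\in\mathcal{N}: f(\mathbf{x})=g(\mathbf{x})=0\},$$ and let $E_i$ denote the connected components of $\mathcal{N}\setminus C$. Suppose that one of the following holds. (a) $C$ is a smooth hypersurface through $\mathbf{p}$ (a smooth curve through $\mathbf{p}$ when $n=2$), and there exists a vector $\mathbf{v}$, not tangent to $C$ at $\mathbf{p}$, such that the directional derivative $D_{\mathbf{v}}g$ is never zero within $\mathcal{N}$. In this case set $\mathbf{v}_i=\mathbf{v}$ for every $i$. (b) More generally, $C$ is a union of two or more smooth hypersurfaces through $\mathbf{p}$ (smooth curves through $\mathbf{p}$ when $n=2$), and for each component $E_i$ of $\mathcal{N}\setminus C$ there is a vector $\mathbf{v}_i$, not tangent at $\mathbf{p}$ to any of the hypersurfaces comprising $C$, such that $D_{\mathbf{v}_i}g\ne 0$ on $E_i$. Suppose that the limits $$\lim_{\substack{\mathbf{x}\to\mathbf{p}\\ \mathbf{x}\in E_i}}\frac{D_{\mathbf{v}_i}f(\mathbf{x})}{D_{\mathbf{v}_i}g(\mathbf{x})}$$ exist and are equal for all $i$. Then $\lim_{\mathbf{x}\to\mathbf{p}} f(\mathbf{x})/g(\mathbf{x})$ exists and $$\lim_{\mathbf{x}\to\mathbf{p}}\frac{f(\mathbf{x})}{g(\mathbf{x})}=\lim_{\substack{\mathbf{x}\to\mathbf{p}\\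 \mathbf{x}\in E_i}}\frac{D_{\mathbf{v}_i}f(\mathbf{x})}{D_{\mathbf{v}_i}g(\mathbf{x})}.$$ Here each limit is taken over the domain of points where the denominator is nonzero (intersected with $E_i$ for the limits on the right), and it is assumed in each case that $\mathbf{p}$ is a limit point of that domain.
   Context: $D_{\mathbf{v}}g$ denotes the directional derivative of $g$ in the direction of the vector $\mathbf{v}$. The point $\mathbf{p}$ need not be an isolated zero of $g$; the limit of $f/g$ at $\mathbf{p}$ is understood as a limit over points where $g\neq 0$.
   Formalization: In case (b), C is taken to be a union of finitely many (at least two) smooth hypersurfaces through p; for infinitely many hypersurfaces, e.g. infinitely many lines through p in the plane, the claim can fail because the limits on the infinitely many components need not be uniform. *)

theory Defs
  imports "HOL-Analysis.Analysis"
begin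

definition dir_deriv :: "'a::real_normed_vector \<Rightarrow> ('a \<Rightarrow> real) \<Rightarrow> 'a \<Rightarrow> real"
  where "dir_deriv v g x = deriv (\<lambda>t. g (x + t *\<^sub>R v)) 0"

(* Class C^k on an open set U: the partial derivatives are the values of the
   Frechet derivative on the standard basis.  Meaningful for open U only. *)
primrec Ck_on :: "nat \<Rightarrow> 'a::euclidean_space set \<Rightarrow> ('a \<Rightarrow> real) \<Rightarrow> bool"
  where
    "Ck_on 0 U \<phi> \<longleftrightarrow> continuous_on U \<phi>"
  | "Ck_on (Suc k) U \<phi> \<longleftrightarrow>
       \<phi> differentiable_on U \<and>
       (\<forall>b\<in>Basis. Ck_on k U (\<lambda>x. frechet_derivative \<phi> (at x) b))"

definition smooth_on :: "'a::euclidean_space set \<Rightarrow> ('a \<Rightarrow> real) \<Rightarrow> bool"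
  where "smooth_on U \<phi> \<longleftrightarrow> (\<forall>k. Ck_on k U \<phi>)"

definition local_defining_function ::
    "'a::euclidean_space set \<Rightarrow> 'a \<Rightarrow> 'a set \<Rightarrow> ('a \<Rightarrow> real) \<Rightarrow> bool"
  where "local_defining_function H x U \<phi> \<longleftrightarrow>
    open U \<and> x \<in> U \<and> smooth_on U \<phi> \<and>
    (\<forall>y\<in>U. frechet_derivative \<phi> (at y) \<noteq> (\<lambda>_. 0)) \<and>
    H \<inter> U = {y \<in> U. \<phi> y = 0}"

(* Embedded hypersurfaces: locally a regular level set.  H is not required to be
   connected, nor to be closed in an ambient open set. *)
definition smooth_hypersurface :: "'a::euclidean_space set \<Rightarrow> bool"
  where "smooth_hypersurface H \<longleftrightarrow> (\<forall>x\<in>H. \<exists>U \<phi>. local_defining_function H x U \<phi>)"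

(* The tangent space at x is the kernel of the differential of a local defining
   function at x; for x in H this kernel does not depend on the function chosen. *)
definition tangent_space :: "'a::euclidean_space set \<Rightarrow> 'a \<Rightarrow> 'a set"
  where "tangent_space H x =
    {v. \<exists>U \<phi>. local_defining_function H x U \<phi> \<and> frechet_derivative \<phi> (at x) v = 0}"

end

theory Submission imports Defs begin

text \<open>
  Near \<open>p\<close> every line in the direction \<open>v\<^sub>i\<close> crosses every hypersurface. Following such a line
  from \<open>x \<in> E\<^sub>i\<close> to the nearest point of \<open>C\<close>, where \<open>f\<close> and \<open>g\<close> vanish, Cauchy's mean value theorem
  turns \<open>f x / g x\<close> into a quotient of directional derivatives at a point of \<open>E\<^sub>i\<close> close to \<open>p\<close>.

  This gives the limit on each component, and it remains to see that there are only finitely many.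
  By Rolle's theorem, a line in the direction \<open>v\<^sub>i\<close> through a point of \<open>E\<^sub>i\<close> cannot meet \<open>C\<close> on both
  sides, so \<open>E\<^sub>i\<close> contains all \<open>p + t u\<close> with small \<open>t > 0\<close> for \<open>u = v\<^sub>i\<close> or \<open>u = - v\<^sub>i\<close>. The signs of
  the differentials at \<open>p\<close> of the local defining functions on \<open>u\<close> then determine \<open>E\<^sub>i\<close>.
\<close>

section \<open>Directional derivatives and mean values along lines\<close>

lemma dir_deriv_eq_frechet_derivative:
  assumes "f differentiable (at x)"
  shows "dir_deriv v f x = frechet_derivative f (at x) v"
proof -
  have "(f has_derivative frechet_derivative f (at x)) (at (x + 0 *\<^sub>R v))"
    using assms by (simp add: frechet_derivative_works)
  then have "((\<lambda>t::real. f (x + t *\<^sub>R v)) has_derivative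
      (\<lambda>t. frechet_derivative f (at x) (t *\<^sub>R v))) (at 0)"
    by (rule has_derivative_compose[rotated]) (auto intro!: derivative_eq_intros)
  then have "((\<lambda>t::real. f (x + t *\<^sub>R v)) has_real_derivative frechet_derivative f (at x) v) (at 0)"
    by (rule has_derivative_imp_has_field_derivative)
      (simp add: linear_cmul[OF linear_frechet_derivative[OF assms]])
  then show ?thesis
    unfolding dir_deriv_def by (rule DERIV_imp_deriv)
qed

lemma dir_deriv_minus:
  assumes "f differentiable (at x)"
  shows "dir_deriv (- v) f x = - dir_deriv v f x"
  using assms by (simp add: dir_deriv_eq_frechet_derivative linear_neg linear_frechet_derivative)

lemma has_real_derivative_along_line:
  assumes "f differentiable (at (x + t *\<^sub>R v))"
  shows "((\<lambda>s. f (x + s *\<^sub>R v)) has_real_derivative dir_deriv v f (x + t *\<^sub>R v)) (at t)"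
proof -
  have "(f has_derivative frechet_derivative f (at (x + t *\<^sub>R v))) (at (x + t *\<^sub>R v))"
    using assms by (simp add: frechet_derivative_works)
  then have "((\<lambda>s::real. f (x + s *\<^sub>R v)) has_derivative
      (\<lambda>s. frechet_derivative f (at (x + t *\<^sub>R v)) (s *\<^sub>R v))) (at t)"
    by (rule has_derivative_compose[rotated]) (auto intro!: derivative_eq_intros)
  then show ?thesis
    by (rule has_derivative_imp_has_field_derivative)
      (simp add: linear_cmul[OF linear_frechet_derivative[OF assms]]
        dir_deriv_eq_frechet_derivative[OF assms])
qed

lemma Cauchy_mean_value_along_line:
  assumes "a < b"
    and "\<And>t. a \<le> t \<Longrightarrow> t \<le> b \<Longrightarrow> f differentiable (at (x + t *\<^sub>R v))"
    and "\<And>t. a \<le> t \<Longrightarrow> t \<le> b \<Longrightarrow> g differentiable (at (x + t *\<^sub>R v))"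
  obtains t where "a < t" "t < b"
    "(f (x + b *\<^sub>R v) - f (x + a *\<^sub>R v)) * dir_deriv v g (x + t *\<^sub>R v) =
     (g (x + b *\<^sub>R v) - g (x + a *\<^sub>R v)) * dir_deriv v f (x + t *\<^sub>R v)"
proof -
  have "\<exists>t. a < t \<and> t < b \<and>
    (f (x + b *\<^sub>R v) - f (x + a *\<^sub>R v)) * dir_deriv v g (x + t *\<^sub>R v) =
    (g (x + b *\<^sub>R v) - g (x + a *\<^sub>R v)) * dir_deriv v f (x + t *\<^sub>R v)"
    using assms
    by (intro GMVT') (auto intro!: has_real_derivative_along_line intro: DERIV_isCont)
  with that show thesis by blast
qed

section \<open>Signs near \<open>p\<close> on the cone over a segment of directions\<close>

lemma eventually_pos_on_cone:
  fixes \<phi> :: "'a::real_normed_vector \<Rightarrow> real"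
  assumes der: "(\<phi> has_derivative \<phi>') (at p)" and "\<phi> p = 0"
    and u: "\<phi>' u > 0" and u': "\<phi>' u' > 0"
  shows "\<forall>\<^sub>F t in at_right 0. \<forall>w\<in>closed_segment u u'. \<phi> (p + t *\<^sub>R w) > 0"
proof -
  interpret bounded_linear \<phi>' using der by (rule has_derivative_bounded_linear)
  \<comment> \<open>By linearity \<open>m\<close> bounds \<open>\<phi>'\<close> from below on the
    whole segment, which makes the estimate uniform in the direction \<open>w\<close>. The summand 1
    in \<open>M\<close> makes the upper bound for \<open>norm w\<close> strict and \<open>M\<close>
    positive.\<close>
  define m where "m = min (\<phi>' u) (\<phi>' u')"
  define M where "M = norm u + norm u' + 1"
  have "m > 0" using u u' by (simp add: m_def)
  have "M > 0" by (simp add: M_def add_nonneg_pos)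
  have lower: "m \<le> \<phi>' w" and upper: "norm w < M" if w: "w \<in> closed_segment u u'" for w
  proof -
    obtain s where s: "0 \<le> s" "s \<le> 1" "w = (1 - s) *\<^sub>R u + s *\<^sub>R u'"
      using w by (auto simp: in_segment)
    have "m = (1 - s) * m + s * m" by (simp add: algebra_simps)
    also have "\<dots> \<le> (1 - s) * \<phi>' u + s * \<phi>' u'"
      using s by (intro add_mono mult_left_mono) (auto simp: m_def)
    also have "\<dots> = \<phi>' w" using s by (simp add: add scaleR)
    finally show "m \<le> \<phi>' w" .
    have "norm w \<le> (1 - s) * norm u + s * norm u'"
      using s norm_triangle_ineq[of "(1 - s) *\<^sub>R u" "s *\<^sub>R u'"] by simp
    also have "\<dots> \<le> norm u + norm u'"
      using s by (intro add_mono mult_left_le_one_le) auto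
    finally show "norm w < M" by (simp add: M_def)
  qed
  \<comment> \<open>With tolerance \<open>m / M\<close>, the error of the linear approximation at
    \<open>p + t *\<^sub>R w\<close> is below \<open>t * m\<close>, hence below the linear term
    \<open>t * \<phi>' w\<close>, which therefore decides the sign.\<close>
  have "m / M > 0" using \<open>m > 0\<close> \<open>M > 0\<close> by simp
  then obtain d where "d > 0"
    and d: "\<And>y. norm (y - p) < d \<Longrightarrow> norm (\<phi> y - \<phi> p - \<phi>' (y - p)) \<le> m / M * norm (y - p)"
    using der unfolding has_derivative_at_alt by blast
  have "\<phi> (p + t *\<^sub>R w) > 0" if t: "0 < t" "t < d / M" and w: "w \<in> closed_segment u u'" for t w
  proof -
    have "t * norm w < t * M" using t upper[OF w] by simp
    also have "t * M < d" using t \<open>M > 0\<close> by (simp add: field_simps)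
    finally have "norm (\<phi> (p + t *\<^sub>R w) - t * \<phi>' w) \<le> m / M * (t * norm w)"
      using d[of "p + t *\<^sub>R w"] t \<open>\<phi> p = 0\<close> by (simp add: scaleR)
    also have "\<dots> < m / M * (t * M)"
      using \<open>t * norm w < t * M\<close> \<open>m / M > 0\<close> by (rule mult_strict_left_mono)
    also have "\<dots> = t * m" using \<open>M > 0\<close> by simp
    also have "\<dots> \<le> t * \<phi>' w" using t lower[OF w] by simp
    finally show ?thesis by (simp add: abs_less_iff)
  qed
  then show ?thesis
    using \<open>d > 0\<close> \<open>M > 0\<close> by (auto simp: eventually_at_right_field intro!: exI[of _ "d / M"])
qed

text \<open>Multiplying the function by the constant \<open>\<phi>' u\<close> reduces both signs to
  the positive case.\<close>

lemma eventually_same_sign_on_cone: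
  fixes \<phi> :: "'a::real_normed_vector \<Rightarrow> real"
  assumes "(\<phi> has_derivative \<phi>') (at p)" and "\<phi> p = 0" and "\<phi>' u * \<phi>' u' > 0"
  shows "\<forall>\<^sub>F t in at_right 0. \<forall>w\<in>closed_segment u u'. \<phi>' u * \<phi> (p + t *\<^sub>R w) > 0"
  using assms
  by (intro eventually_pos_on_cone[of "\<lambda>x. \<phi>' u * \<phi> x" "\<lambda>x. \<phi>' u * \<phi>' x"])
    (auto intro!: derivative_eq_intros simp: zero_less_mult_iff)

section \<open>Components of the complement of \<open>C\<close> and the lines through them\<close>

lemma component_absorbs_connected:
  assumes "E \<in> components S" "connected T" "T \<subseteq> S" "x \<in> E" "x \<in> T"
  shows "T \<subseteq> E"
  using components_maximal[OF assms(1-3)] assms(4,5) by blast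

text \<open>The common local form of both cases of the theorem. All local defining functions live on
  one ball around \<open>p\<close>, where \<open>C\<close> is the union of their zero sets. Away
  from \<open>p\<close> only their continuity is kept; their differentials enter at \<open>p\<close>
  alone.\<close>

locale hypersurfaces_through_point =
  fixes N C :: "'a::euclidean_space set" and p :: 'a and f g :: "'a \<Rightarrow> real"
    and \<H> :: "'h set" and \<phi> \<phi>' :: "'h \<Rightarrow> 'a \<Rightarrow> real" and r :: real
  assumes open_N: "open N"
    and diff_f: "f differentiable_on N" and diff_g: "g differentiable_on N"
    and C_eq: "C = {x \<in> N. f x = 0 \<and> g x = 0}"
    and r_pos: "r > 0" and ball_subset: "ball p r \<subseteq> N"
    and finite_H: "finite \<H>" and nonempty_H: "\<H> \<noteq> {}"
    and C_local: "\<And>y. y \<in> ball p r \<Longrightarrow> y \<in> C \<longleftrightarrow> (\<exists>H\<in>\<H>. \<phi> H y = 0)"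
    and cont: "\<And>H. H \<in> \<H> \<Longrightarrow> continuous_on (ball p r) (\<phi> H)"
    and der: "\<And>H. H \<in> \<H> \<Longrightarrow> (\<phi> H has_derivative \<phi>' H) (at p)"
    and zero_p: "\<And>H. H \<in> \<H> \<Longrightarrow> \<phi> H p = 0"
begin

lemma p_in_C: "p \<in> C"
  using C_local[of p] r_pos nonempty_H zero_p by auto

lemma diff_at: "x \<in> N \<Longrightarrow> f differentiable (at x)" "x \<in> N \<Longrightarrow> g differentiable (at x)"
  using diff_f diff_g open_N by (auto simp: differentiable_on_eq_differentiable_at)

lemma nearest_zero_on_ray:
  assumes "x \<notin> C" "b \<ge> 0" "x + b *\<^sub>R u \<in> C" and seg: "\<And>s. 0 \<le> s \<Longrightarrow> s \<le> b \<Longrightarrow> x + s *\<^sub>R u \<in> N"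
  obtains s where "0 < s" "s \<le> b" "x + s *\<^sub>R u \<in> C"
    "\<And>s'. 0 \<le> s' \<Longrightarrow> s' < s \<Longrightarrow> x + s' *\<^sub>R u \<in> N - C"
proof -
  \<comment> \<open>Written through \<open>f\<close> and \<open>g\<close>, the set of parameters
    that hit \<open>C\<close> is closed by continuity, because the segment stays in
    \<open>N\<close>. It is then compact, and its minimum is the nearest hit.\<close>
  define T where "T = {s \<in> {0..b}. f (x + s *\<^sub>R u) = 0} \<inter> {s \<in> {0..b}. g (x + s *\<^sub>R u) = 0}"
  have T: "s \<in> T \<longleftrightarrow> 0 \<le> s \<and> s \<le> b \<and> x + s *\<^sub>R u \<in> C" for s
    using seg by (auto simp: T_def C_eq)
  have cts: "continuous_on {0..b} (\<lambda>s. h (x + s *\<^sub>R u))"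
    if "h differentiable_on N" for h :: "'a \<Rightarrow> real"
    using seg by (intro continuous_on_compose2[OF differentiable_imp_continuous_on[OF that]])
      (auto intro!: continuous_intros)
  have "closed T"
    unfolding T_def by (intro closed_Int continuous_closed_preimage_constant cts diff_f diff_g) auto
  moreover have "bounded T"
    by (rule bounded_subset[of "{0..b}"]) (auto simp: T_def)
  moreover have "b \<in> T" using assms by (simp add: T)
  ultimately obtain s where s: "s \<in> T" "\<And>s'. s' \<in> T \<Longrightarrow> s \<le> s'"
    using compact_attains_inf[of T] by (auto simp: compact_eq_bounded_closed)
  show thesis
  proof
    have "s \<noteq> 0" using s(1) assms(1) by (auto simp: T)
    then show "0 < s" using s(1) by (simp add: T)
    show "s \<le> b" "x + s *\<^sub>R u \<in> C" using s(1) by (auto simp: T)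
    show "x + s' *\<^sub>R u \<in> N - C" if "0 \<le> s'" "s' < s" for s'
      using that s(2)[of s'] seg[of s'] \<open>s \<le> b\<close> by (auto simp: T)
  qed
qed

lemma line_part_in_component:
  assumes "E \<in> components (N - C)" "x \<in> E" "is_interval I" "0 \<in> I"
    and "\<And>s. s \<in> I \<Longrightarrow> x + s *\<^sub>R u \<in> N - C"
    and "s \<in> I"
  shows "x + s *\<^sub>R u \<in> E"
proof -
  have "connected ((\<lambda>s. x + s *\<^sub>R u) ` I)"
    using assms by (intro connected_continuous_image) (auto intro!: continuous_intros simp: is_interval_connected)
  moreover have "x = x + 0 *\<^sub>R u" by simp
  then have "x \<in> (\<lambda>s. x + s *\<^sub>R u) ` I" using assms(4) by blast
  ultimately have "(\<lambda>s. x + s *\<^sub>R u) ` I \<subseteq> E"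
    using assms by (intro component_absorbs_connected[of E "N - C" _ x]) auto
  then show ?thesis using assms by auto
qed

text \<open>Rolle's theorem between the nearest points of \<open>C\<close> on the two sides of
  \<open>x\<close>: \<open>g\<close> vanishes at both, so its derivative along \<open>u\<close>
  vanishes somewhere strictly between. The open stretch between them avoids \<open>C\<close> and
  contains \<open>x\<close>, so that point lies in \<open>E\<close>, against
  \<open>D\<close>.\<close>

lemma no_zero_on_both_sides:
  assumes E: "E \<in> components (N - C)" "x \<in> E" and D: "\<And>y. y \<in> E \<Longrightarrow> dir_deriv u g y \<noteq> 0"
    and "a \<ge> 0" "x - a *\<^sub>R u \<in> C" "\<And>s. 0 \<le> s \<Longrightarrow> s \<le> a \<Longrightarrow> x - s *\<^sub>R u \<in> N"
    and "b \<ge> 0" "x + b *\<^sub>R u \<in> C" "\<And>s. 0 \<le> s \<Longrightarrow> s \<le> b \<Longrightarrow> x + s *\<^sub>R u \<in> N"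
  shows False
proof -
  have "x \<notin> C" using E in_components_subset by fastforce
  obtain s where s: "0 < s" "s \<le> b" "x + s *\<^sub>R u \<in> C"
      "\<And>s'. 0 \<le> s' \<Longrightarrow> s' < s \<Longrightarrow> x + s' *\<^sub>R u \<in> N - C"
    using nearest_zero_on_ray[of x b u] assms \<open>x \<notin> C\<close> by blast
  obtain t where t: "0 < t" "t \<le> a" "x + t *\<^sub>R (- u) \<in> C"
      "\<And>s'. 0 \<le> s' \<Longrightarrow> s' < t \<Longrightarrow> x + s' *\<^sub>R (- u) \<in> N - C"
    using nearest_zero_on_ray[of x a "- u"] assms \<open>x \<notin> C\<close> by auto
  have inner: "x + q *\<^sub>R u \<in> N - C" if "- t < q" "q < s" for q
    using s(4)[of q] t(4)[of "- q"] that by (cases "q \<ge> 0") auto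
  have "x + q *\<^sub>R u \<in> N" if "- t \<le> q" "q \<le> s" for q
    using assms(6)[of "- q"] assms(9)[of q] that s(2) t(2) by (cases "q \<ge> 0") auto
  then have "\<exists>q>- t. q < s \<and>
      g (x + s *\<^sub>R u) - g (x + (- t) *\<^sub>R u) = (s - - t) * dir_deriv u g (x + q *\<^sub>R u)"
    using s(1) t(1) diff_at by (intro MVT2) (auto intro!: has_real_derivative_along_line)
  moreover have "g (x + (- t) *\<^sub>R u) = 0" "g (x + s *\<^sub>R u) = 0"
    using s(3) t(3) by (auto simp: C_eq)
  ultimately obtain q where "- t < q" "q < s" "dir_deriv u g (x + q *\<^sub>R u) = 0"
    using s(1) t(1) by auto
  moreover have "x + q *\<^sub>R u \<in> E"
    using E inner \<open>- t < q\<close> \<open>q < s\<close> s(1) t(1)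
    by (intro line_part_in_component[of E x "{- t<..<s}" u q]) (auto intro: is_interval_io)
  ultimately show False using D by blast
qed

lemma line_between_in_ball:
  assumes "x + a *\<^sub>R u \<in> ball p r" "x + b *\<^sub>R u \<in> ball p r" "a \<le> s" "s \<le> b"
  shows "x + s *\<^sub>R u \<in> ball p r"
proof -
  have "x + t *\<^sub>R u \<in> ball p r \<longleftrightarrow> t \<in> (\<lambda>t. t *\<^sub>R u) -` ball (p - x) r" for t
    by (simp add: dist_norm algebra_simps)
  moreover have "is_interval ((\<lambda>t. t *\<^sub>R u) -` ball (p - x) r)"
    by (simp add: is_interval_convex_1 convex_linear_vimage)
  ultimately show ?thesis
    using assms mem_is_interval_1_I[of "(\<lambda>t. t *\<^sub>R u) -` ball (p - x) r" a b s] by blast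
qed

section \<open>Sign patterns and the finiteness of the set of components\<close>

lemma not_in_C_of_sign:
  assumes "y \<in> ball p r" and "\<And>H. H \<in> \<H> \<Longrightarrow> c H * \<phi> H y > 0"
  shows "y \<in> N - C"
  using assms(1) ball_subset C_local[of y] assms(2) by force

lemma eventually_cone_in_ball:
  "\<forall>\<^sub>F t in at_right 0. \<forall>w\<in>closed_segment u u'. p + t *\<^sub>R w \<in> ball p r"
proof -
  define M where "M = norm u + norm u' + 1"
  have "M > 0" by (simp add: M_def add_nonneg_pos)
  have "p + t *\<^sub>R w \<in> ball p r" if t: "0 < t" "t < r / M" and w: "w \<in> closed_segment u u'" for t w
  proof -
    have "closed_segment u u' \<subseteq> cball 0 M"
      by (intro closed_segment_subset) (auto simp: M_def)
    with w have "norm w \<le> M" by auto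
    then have "t * norm w \<le> t * M" using t by simp
    also have "\<dots> < r" using t \<open>M > 0\<close> by (simp add: field_simps)
    finally show ?thesis using t by (simp add: dist_norm)
  qed
  then show ?thesis
    using r_pos \<open>M > 0\<close> by (auto simp: eventually_at_right_field intro!: exI[of _ "r / M"])
qed

lemma eventually_sign_on_cone:
  assumes "\<And>H. H \<in> \<H> \<Longrightarrow> \<phi>' H u * \<phi>' H u' > 0"
  shows "\<forall>\<^sub>F t in at_right 0. \<forall>w\<in>closed_segment u u'.
    p + t *\<^sub>R w \<in> ball p r \<and> (\<forall>H\<in>\<H>. \<phi>' H u * \<phi> H (p + t *\<^sub>R w) > 0)"
proof -
  have "\<forall>\<^sub>F t in at_right 0. \<forall>H\<in>\<H>. \<forall>w\<in>closed_segment u u'. \<phi>' H u * \<phi> H (p + t *\<^sub>R w) > 0"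
    using finite_H assms der zero_p
    by (intro eventually_ball_finite ballI eventually_same_sign_on_cone) auto
  with eventually_cone_in_ball[of u u'] show ?thesis
    by eventually_elim auto
qed

text \<open>For small \<open>t\<close> the segment from \<open>p + t *\<^sub>R u\<close> to
  \<open>p + t *\<^sub>R u'\<close> avoids \<open>C\<close>, since on it every defining function
  keeps the common sign of its differential on \<open>u\<close> and \<open>u'\<close>. Being
  connected, the segment joins \<open>E\<close> to \<open>E'\<close>.\<close>

lemma component_determined_by_signs:
  assumes E: "E \<in> components (N - C)" "E' \<in> components (N - C)"
    and u: "\<forall>\<^sub>F t in at_right 0. p + t *\<^sub>R u \<in> E" and u': "\<forall>\<^sub>F t in at_right 0. p + t *\<^sub>R u' \<in> E'"
    and "\<And>H. H \<in> \<H> \<Longrightarrow> \<phi>' H u * \<phi>' H u' > 0"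
  shows "E = E'"
proof -
  have sign: "\<forall>\<^sub>F t in at_right 0. \<forall>w\<in>closed_segment u u'.
      p + t *\<^sub>R w \<in> ball p r \<and> (\<forall>H\<in>\<H>. \<phi>' H u * \<phi> H (p + t *\<^sub>R w) > 0)"
    using assms(5) by (rule eventually_sign_on_cone)
  \<comment> \<open>The claim does not depend on \<open>t\<close>, and the filter is nontrivial, so
    it is enough to prove it eventually.\<close>
  have "\<forall>\<^sub>F t in at_right (0::real). E = E'"
    using u u' sign
  proof eventually_elim
    case (elim t)
    define S where "S = (\<lambda>w. p + t *\<^sub>R w) ` closed_segment u u'"
    have "connected S"
      unfolding S_def by (intro connected_continuous_image) (auto intro!: continuous_intros)
    moreover have "S \<subseteq> N - C"
      using elim(3) not_in_C_of_sign[of _ "\<lambda>H. \<phi>' H u"] unfolding S_def by blast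
    moreover have "p + t *\<^sub>R u \<in> S" "p + t *\<^sub>R u' \<in> S" unfolding S_def by auto
    ultimately have "p + t *\<^sub>R u \<in> E'"
      using component_absorbs_connected[OF E(2)] elim(2) by blast
    with elim(1) show ?case using components_nonoverlap[OF E] by blast
  qed
  then show ?thesis by simp
qed

text \<open>By continuity at \<open>p + w\<close>. This carries signs known on a line through
  \<open>p\<close> over to the parallel lines through nearby points.\<close>

lemma eventually_sign_translate:
  assumes H: "H \<in> \<H>" and w: "p + w \<in> ball p r" "c * \<phi> H (p + w) > 0"
  shows "\<forall>\<^sub>F y in nhds p. y + w \<in> ball p r \<and> c * \<phi> H (y + w) > 0"
proof -
  have "isCont (\<lambda>y. c * \<phi> H y) (p + w)"
    using cont[OF H] w(1) by (intro continuous_intros) (auto simp: continuous_on_eq_continuous_at)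
  then have "((\<lambda>y. c * \<phi> H y) \<longlongrightarrow> c * \<phi> H (p + w)) (nhds (p + w))"
    unfolding isCont_def using tendsto_at_iff_tendsto_nhds[of "\<lambda>y. c * \<phi> H y" "p + w"] by simp
  then have "\<forall>\<^sub>F y in nhds (p + w). c * \<phi> H y > 0"
    using w(2) order_tendstoD(1) by blast
  moreover have "\<forall>\<^sub>F y in nhds (p + w). y \<in> ball p r"
    using w(1) by (intro eventually_nhds_in_open) auto
  ultimately have "\<forall>\<^sub>F y in nhds (p + w). y \<in> ball p r \<and> c * \<phi> H y > 0"
    by eventually_elim auto
  moreover have "((\<lambda>y. y + w) \<longlongrightarrow> p + w) (nhds p)"
    by (intro tendsto_intros filterlim_ident)
  ultimately show ?thesis unfolding filterlim_iff by blast
qed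

text \<open>A path inside \<open>N - C\<close> in three pieces: from \<open>x\<close> along
  \<open>u\<close> to \<open>x + \<epsilon> *\<^sub>R u\<close>, then within the translated ball to
  \<open>p + \<epsilon> *\<^sub>R u\<close>, then back along the ray towards \<open>p\<close>. The
  last piece stops short of \<open>p\<close>, which belongs to \<open>C\<close>; hence the half-open
  interval below.\<close>

lemma ray_in_component:
  assumes E: "E \<in> components (N - C)" and x: "x \<in> E" "dist p x < d" and "\<epsilon> > 0"
    and no_hit: "\<And>s. 0 \<le> s \<Longrightarrow> s \<le> \<epsilon> \<Longrightarrow> x + s *\<^sub>R u \<in> N - C"
    and end_free: "\<And>y. dist p y < d \<Longrightarrow> y + \<epsilon> *\<^sub>R u \<in> N - C"
    and ray: "\<And>s. 0 < s \<Longrightarrow> s \<le> \<epsilon> \<Longrightarrow> p + s *\<^sub>R u \<in> N - C"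
  shows "\<forall>\<^sub>F t in at_right 0. p + t *\<^sub>R u \<in> E"
proof -
  have "x + \<epsilon> *\<^sub>R u \<in> E"
    using \<open>\<epsilon> > 0\<close> by (intro line_part_in_component[OF E x(1), of "{0..\<epsilon>}"] no_hit) (auto simp: is_interval_cc)
  moreover have "connected ((\<lambda>y. y + \<epsilon> *\<^sub>R u) ` ball p d)"
    by (intro connected_continuous_image) (auto intro!: continuous_intros)
  moreover have "(\<lambda>y. y + \<epsilon> *\<^sub>R u) ` ball p d \<subseteq> N - C"
    using end_free by auto
  moreover have "d > 0" using x(2) zero_le_dist[of p x] by linarith
  ultimately have "p + \<epsilon> *\<^sub>R u \<in> E"
    using component_absorbs_connected[OF E, of "(\<lambda>y. y + \<epsilon> *\<^sub>R u) ` ball p d" "x + \<epsilon> *\<^sub>R u"] x(2)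
    by auto
  have "p + s *\<^sub>R u \<in> E" if "0 < s" "s < \<epsilon>" for s
  proof -
    have shift: "p + \<epsilon> *\<^sub>R u + q *\<^sub>R u = p + (\<epsilon> + q) *\<^sub>R u" for q
      by (simp add: scaleR_add_left)
    have "p + \<epsilon> *\<^sub>R u + (s - \<epsilon>) *\<^sub>R u \<in> E"
    proof (rule line_part_in_component[OF E \<open>p + \<epsilon> *\<^sub>R u \<in> E\<close>])
      show "p + \<epsilon> *\<^sub>R u + q *\<^sub>R u \<in> N - C" if "q \<in> {-\<epsilon><..0}" for q
        using ray[of "\<epsilon> + q"] that unfolding shift by auto
    qed (use that in \<open>auto simp: is_interval_oc\<close>)
    then show ?thesis unfolding shift by simp
  qed
  then show ?thesis
    using \<open>\<epsilon> > 0\<close> by (auto simp: eventually_at_right_field intro!: exI[of _ \<epsilon>])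
qed

text \<open>Take \<open>x\<close> in \<open>E\<close> close to \<open>p\<close>. Of the two short
  segments from \<open>x\<close> in the directions \<open>v\<close> and \<open>- v\<close>, at least
  one misses \<open>C\<close>, since otherwise \<open>no_zero_on_both_sides\<close> applies. That
  direction is \<open>u\<close>, and the free segment leads from \<open>x\<close> to the ray from
  \<open>p\<close>.\<close>

lemma component_contains_ray:
  assumes E: "E \<in> components (N - C)" and "p islimpt E"
    and v: "\<And>H. H \<in> \<H> \<Longrightarrow> \<phi>' H v \<noteq> 0"
    and D: "\<And>y. y \<in> E \<Longrightarrow> dir_deriv v g y \<noteq> 0"
  shows "\<exists>u\<in>{v, - v}. \<forall>\<^sub>F t in at_right 0. p + t *\<^sub>R u \<in> E"
proof -
  have neg: "\<phi>' H (- w) = - \<phi>' H w" if "H \<in> \<H>" for H w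
    using linear_neg[OF has_derivative_linear[OF der[OF that]]] .
  have "\<forall>\<^sub>F t in at_right 0. p + t *\<^sub>R u \<in> ball p r \<and> (\<forall>H\<in>\<H>. \<phi>' H u * \<phi> H (p + t *\<^sub>R u) > 0)"
    if "u \<in> {v, - v}" for u
  proof -
    have "\<phi>' H u * \<phi>' H u > 0" if "H \<in> \<H>" for H
      using v[OF that] neg[OF that, of v] \<open>u \<in> {v, - v}\<close> by (auto simp: zero_less_mult_iff)
    then show ?thesis using eventually_sign_on_cone[of u u] by simp
  qed
  then have "\<forall>\<^sub>F t in at_right 0. \<forall>u\<in>{v, - v}.
      p + t *\<^sub>R u \<in> ball p r \<and> (\<forall>H\<in>\<H>. \<phi>' H u * \<phi> H (p + t *\<^sub>R u) > 0)"
    by (intro eventually_ball_finite ballI) auto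
  then obtain b where "b > 0" and b: "\<And>t u. 0 < t \<Longrightarrow> t < b \<Longrightarrow> u \<in> {v, - v} \<Longrightarrow>
      p + t *\<^sub>R u \<in> ball p r \<and> (\<forall>H\<in>\<H>. \<phi>' H u * \<phi> H (p + t *\<^sub>R u) > 0)"
    unfolding eventually_at_right_field by blast
  define \<epsilon> where "\<epsilon> = b / 2"
  have "0 < \<epsilon>" "\<epsilon> < b" using \<open>b > 0\<close> by (auto simp: \<epsilon>_def)
  have ray: "p + s *\<^sub>R u \<in> N - C" if "0 < s" "s \<le> \<epsilon>" "u \<in> {v, - v}" for s u
    using b[of s u] that \<open>\<epsilon> < b\<close> by (intro not_in_C_of_sign[of _ "\<lambda>H. \<phi>' H u"]) auto
  \<comment> \<open>The length \<open>\<epsilon>\<close> is fixed before the radius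
    \<open>d\<close>: for every \<open>y\<close> within \<open>d\<close> of \<open>p\<close>, the
    ends \<open>y + \<epsilon> *\<^sub>R u\<close> have the same signs as
    \<open>p + \<epsilon> *\<^sub>R u\<close>.\<close>
  have "\<forall>\<^sub>F y in nhds p. \<forall>u\<in>{v, - v}. \<forall>H\<in>\<H>.
      y + \<epsilon> *\<^sub>R u \<in> ball p r \<and> \<phi>' H u * \<phi> H (y + \<epsilon> *\<^sub>R u) > 0"
    using b[OF \<open>0 < \<epsilon>\<close> \<open>\<epsilon> < b\<close>]
    by (intro eventually_ball_finite ballI finite_H eventually_sign_translate) auto
  then obtain d where "d > 0" and d: "\<And>y u. dist y p < d \<Longrightarrow> u \<in> {v, - v} \<Longrightarrow>
      \<forall>H\<in>\<H>. y + \<epsilon> *\<^sub>R u \<in> ball p r \<and> \<phi>' H u * \<phi> H (y + \<epsilon> *\<^sub>R u) > 0"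
    unfolding eventually_nhds_metric by blast
  \<comment> \<open>Membership in the ball stands under the quantifier over \<open>\<H>\<close>, so
    \<open>nonempty_H\<close> is what extracts it.\<close>
  have end_free: "y + \<epsilon> *\<^sub>R u \<in> N - C" if "dist p y < d" "u \<in> {v, - v}" for y u
    using d[of y u] that nonempty_H
    by (intro not_in_C_of_sign[of _ "\<lambda>H. \<phi>' H u"]) (auto simp: dist_commute)
  \<comment> \<open>The bound \<open>r\<close> puts \<open>x\<close> itself into the ball, so that
    by convexity the segments from \<open>x\<close> stay in \<open>N\<close>.\<close>
  define \<delta> where "\<delta> = min d r"
  have "\<delta> > 0" using \<open>d > 0\<close> r_pos by (simp add: \<delta>_def)
  then obtain x where x: "x \<in> E" "dist p x < \<delta>"
    using \<open>p islimpt E\<close> by (metis islimpt_approachable dist_commute)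
  have in_N: "x + s *\<^sub>R u \<in> N" if "0 \<le> s" "s \<le> \<epsilon>" "u \<in> {v, - v}" for s u
  proof -
    have "x \<in> ball p r" "x + \<epsilon> *\<^sub>R u \<in> ball p r"
      using x d[of x u] that nonempty_H by (auto simp: \<delta>_def dist_commute)
    then have "x + s *\<^sub>R u \<in> ball p r"
      using line_between_in_ball[of x 0 u \<epsilon> s] that by simp
    then show ?thesis using ball_subset by blast
  qed
  have "\<exists>u\<in>{v, - v}. \<forall>s. 0 \<le> s \<and> s \<le> \<epsilon> \<longrightarrow> x + s *\<^sub>R u \<notin> C"
  proof (rule ccontr)
    assume "\<not> ?thesis"
    then obtain s t where "0 \<le> s" "s \<le> \<epsilon>" "x + s *\<^sub>R v \<in> C" "0 \<le> t" "t \<le> \<epsilon>" "x - t *\<^sub>R v \<in> C"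
      by auto
    then show False
      using no_zero_on_both_sides[OF E x(1) D, of t s] in_N[of _ v] in_N[of _ "- v"] by auto
  qed
  then obtain u where u: "u \<in> {v, - v}" "\<And>s. 0 \<le> s \<Longrightarrow> s \<le> \<epsilon> \<Longrightarrow> x + s *\<^sub>R u \<in> N - C"
    using in_N by blast
  moreover have "dist p x < d" using x by (simp add: \<delta>_def)
  ultimately have "\<forall>\<^sub>F t in at_right 0. p + t *\<^sub>R u \<in> E"
    using ray_in_component[OF E x(1) _ \<open>\<epsilon> > 0\<close>] end_free ray by blast
  with u(1) show ?thesis by blast
qed

text \<open>Each component contains the start of a ray from \<open>p\<close>, and the signs of the
  differentials on its direction determine the component. So there are at most as many components as
  subsets of \<open>\<H>\<close>.\<close>

lemma finite_components:
  assumes lim: "\<And>E. E \<in> components (N - C) \<Longrightarrow> p islimpt E"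
    and v: "\<And>E H. E \<in> components (N - C) \<Longrightarrow> H \<in> \<H> \<Longrightarrow> \<phi>' H (v E) \<noteq> 0"
    and D: "\<And>E y. E \<in> components (N - C) \<Longrightarrow> y \<in> E \<Longrightarrow> dir_deriv (v E) g y \<noteq> 0"
  shows "finite (components (N - C))"
proof -
  have "\<forall>E\<in>components (N - C). \<exists>u. u \<in> {v E, - v E} \<and> (\<forall>\<^sub>F t in at_right 0. p + t *\<^sub>R u \<in> E)"
  proof
    fix E assume E: "E \<in> components (N - C)"
    show "\<exists>u. u \<in> {v E, - v E} \<and> (\<forall>\<^sub>F t in at_right 0. p + t *\<^sub>R u \<in> E)"
      using component_contains_ray[OF E lim[OF E] v[OF E] D[OF E]] by blast
  qed
  from bchoice[OF this] obtain u where
    "\<forall>E\<in>components (N - C). u E \<in> {v E, - v E} \<and> (\<forall>\<^sub>F t in at_right 0. p + t *\<^sub>R u E \<in> E)" ..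
  then have u: "u E \<in> {v E, - v E}" "\<forall>\<^sub>F t in at_right 0. p + t *\<^sub>R u E \<in> E"
    if "E \<in> components (N - C)" for E
    using that by simp_all
  have nz: "\<phi>' H (u E) \<noteq> 0" if "E \<in> components (N - C)" "H \<in> \<H>" for E H
    using u(1)[OF that(1)] v[OF that] linear_neg[OF has_derivative_linear[OF der[OF that(2)]]] by auto
  \<comment> \<open>No differential vanishes on \<open>u E\<close>, so recording the positive ones
    records the full sign pattern.\<close>
  define \<sigma> where "\<sigma> E = {H \<in> \<H>. \<phi>' H (u E) > 0}" for E
  have "inj_on \<sigma> (components (N - C))"
  proof
    fix E E' assume EE: "E \<in> components (N - C)" "E' \<in> components (N - C)" "\<sigma> E = \<sigma> E'"
    have "\<phi>' H (u E) * \<phi>' H (u E') > 0" if "H \<in> \<H>" for H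
    proof -
      have "\<phi>' H (u E) > 0 \<longleftrightarrow> \<phi>' H (u E') > 0" using EE(3) that by (auto simp: \<sigma>_def)
      then show ?thesis using nz[OF EE(1) that] nz[OF EE(2) that] by (auto simp: zero_less_mult_iff)
    qed
    then show "E = E'"
      using EE u(2) by (intro component_determined_by_signs) auto
  qed
  moreover have "\<sigma> ` components (N - C) \<subseteq> Pow \<H>" by (auto simp: \<sigma>_def)
  ultimately show ?thesis using finite_H finite_subset finite_imageD by (metis finite_Pow_iff)
qed

section \<open>The limit of the quotient on a single component\<close>

lemma eventually_line_meets_C:
  assumes "H \<in> \<H>" "\<phi>' H v \<noteq> 0" "\<epsilon> > 0"
  shows "\<forall>\<^sub>F x in nhds p. \<exists>s. \<bar>s\<bar> \<le> \<epsilon> \<and> x + s *\<^sub>R v \<in> C"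
proof -
  interpret lin: bounded_linear "\<phi>' H" using der[OF assms(1)] by (rule has_derivative_bounded_linear)
  have cone: "\<forall>\<^sub>F t in at_right 0. p + t *\<^sub>R u \<in> ball p r \<and> \<phi>' H u * \<phi> H (p + t *\<^sub>R u) > 0"
    if "u \<in> {v, - v}" for u
  proof -
    have "\<phi>' H u * \<phi>' H u > 0"
      using that assms(2) by (auto simp: lin.neg zero_less_mult_iff not_less)
    from eventually_cone_in_ball[of u u] eventually_same_sign_on_cone[OF der[OF assms(1)] zero_p[OF assms(1)] this]
    show ?thesis by eventually_elim auto
  qed
  have "\<forall>\<^sub>F t in at_right 0. t < \<epsilon>"
    using \<open>\<epsilon> > 0\<close> by (auto simp: eventually_at_right_field)
  then have "\<forall>\<^sub>F t in at_right 0. 0 < t \<and> t < \<epsilon> \<and>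
     (p + t *\<^sub>R v \<in> ball p r \<and> \<phi>' H v * \<phi> H (p + t *\<^sub>R v) > 0) \<and>
     (p + t *\<^sub>R (- v) \<in> ball p r \<and> \<phi>' H (- v) * \<phi> H (p + t *\<^sub>R (- v)) > 0)"
    using cone[of v] cone[of "- v"]
    by (intro eventually_conj[OF eventually_at_right_less eventually_conj[OF _ eventually_conj]]) blast+
  then have "\<exists>t. 0 < t \<and> t < \<epsilon> \<and>
     (p + t *\<^sub>R v \<in> ball p r \<and> \<phi>' H v * \<phi> H (p + t *\<^sub>R v) > 0) \<and>
     (p + t *\<^sub>R (- v) \<in> ball p r \<and> \<phi>' H (- v) * \<phi> H (p + t *\<^sub>R (- v)) > 0)"
    by (rule eventually_happens'[OF trivial_limit_at_right_real])
  then obtain t where t: "0 < t" "t < \<epsilon>"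
     "p + t *\<^sub>R v \<in> ball p r" "\<phi>' H v * \<phi> H (p + t *\<^sub>R v) > 0"
     "p - t *\<^sub>R v \<in> ball p r" "\<phi>' H v * \<phi> H (p - t *\<^sub>R v) < 0"
    by (auto simp: lin.neg)
  \<comment> \<open>The opposite signs at \<open>p + t *\<^sub>R v\<close> and
    \<open>p - t *\<^sub>R v\<close> persist at \<open>x + t *\<^sub>R v\<close> and
    \<open>x - t *\<^sub>R v\<close> for \<open>x\<close> near \<open>p\<close>. The intermediate
    value theorem then yields a zero of \<open>\<phi> H\<close> between them, a point of
    \<open>C\<close>.\<close>
  from eventually_sign_translate[OF assms(1), of "t *\<^sub>R v" "\<phi>' H v"]
    eventually_sign_translate[OF assms(1), of "(- t) *\<^sub>R v" "- \<phi>' H v"] t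
  have "\<forall>\<^sub>F x in nhds p. x + t *\<^sub>R v \<in> ball p r \<and> \<phi>' H v * \<phi> H (x + t *\<^sub>R v) > 0"
    "\<forall>\<^sub>F x in nhds p. x + (- t) *\<^sub>R v \<in> ball p r \<and> (- \<phi>' H v) * \<phi> H (x + (- t) *\<^sub>R v) > 0"
    by auto
  then show ?thesis
  proof eventually_elim
    case (elim x)
    then have in_ball: "x + s *\<^sub>R v \<in> ball p r" if "- t \<le> s" "s \<le> t" for s
      using line_between_in_ball[of x "- t" v t s] that by simp
    have "continuous_on {- t..t} (\<lambda>s. \<phi>' H v * \<phi> H (x + s *\<^sub>R v))"
      using in_ball
      by (intro continuous_on_mult_left continuous_on_compose2[OF cont[OF assms(1)]])
        (auto intro!: continuous_intros)
    then have "\<exists>s. - t \<le> s \<and> s \<le> t \<and> \<phi>' H v * \<phi> H (x + s *\<^sub>R v) = 0"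
      using elim t by (intro IVT') auto
    then obtain s where "- t \<le> s" "s \<le> t" "\<phi> H (x + s *\<^sub>R v) = 0" using assms(2) by auto
    then show ?case
      using C_local[OF in_ball] assms(1) t(2) by (intro exI[of _ s]) auto
  qed
qed

text \<open>Cauchy's mean value theorem between \<open>x\<close> and the nearest point of
  \<open>C\<close> on the ray, where \<open>f\<close> and \<open>g\<close> vanish. Stopping at the
  nearest one keeps the intermediate point in \<open>E\<close>. The product form also covers
  vanishing denominators.\<close>

lemma quotient_eq_at_near_point:
  assumes E: "E \<in> components (N - C)" "x \<in> E"
    and "b \<ge> 0" "x + b *\<^sub>R u \<in> C" and seg: "\<And>s. 0 \<le> s \<Longrightarrow> s \<le> b \<Longrightarrow> x + s *\<^sub>R u \<in> N"
  obtains s where "0 < s" "s < b" "x + s *\<^sub>R u \<in> E"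
    "f x * dir_deriv u g (x + s *\<^sub>R u) = g x * dir_deriv u f (x + s *\<^sub>R u)"
proof -
  have "x \<notin> C" using E in_components_subset by fastforce
  obtain s where s: "0 < s" "s \<le> b" "x + s *\<^sub>R u \<in> C"
      "\<And>s'. 0 \<le> s' \<Longrightarrow> s' < s \<Longrightarrow> x + s' *\<^sub>R u \<in> N - C"
    using nearest_zero_on_ray[of x b u] assms \<open>x \<notin> C\<close> by blast
  obtain q where q: "0 < q" "q < s"
    "(f (x + s *\<^sub>R u) - f (x + 0 *\<^sub>R u)) * dir_deriv u g (x + q *\<^sub>R u) =
     (g (x + s *\<^sub>R u) - g (x + 0 *\<^sub>R u)) * dir_deriv u f (x + q *\<^sub>R u)"
    using Cauchy_mean_value_along_line[of 0 s f x u g] s(1,2) seg diff_at by auto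
  have "f (x + s *\<^sub>R u) = 0" "g (x + s *\<^sub>R u) = 0" using s(3) by (auto simp: C_eq)
  moreover have "x + q *\<^sub>R u \<in> E"
    using s q by (intro line_part_in_component[OF E, of "{0..<s}"]) (auto simp: is_interval_co)
  ultimately show thesis using that[of q] q s by auto
qed

lemma quotient_near_limit_on_component:
  assumes E: "E \<in> components (N - C)"
    and H: "H \<in> \<H>" "\<phi>' H v \<noteq> 0"
    and D: "\<And>y. y \<in> E \<Longrightarrow> dir_deriv v g y \<noteq> 0"
    and lim: "((\<lambda>x. dir_deriv v f x / dir_deriv v g x) \<longlongrightarrow> L) (at p within {x \<in> E. dir_deriv v g x \<noteq> 0})"
    and "e > 0"
  shows "\<forall>\<^sub>F x in at p. x \<in> E \<and> g x \<noteq> 0 \<longrightarrow> dist (f x / g x) L < e"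
proof -
  have "{x \<in> E. dir_deriv v g x \<noteq> 0} = E" using D by auto
  then have "\<forall>\<^sub>F x in at p within E. dist (dir_deriv v f x / dir_deriv v g x) L < e"
    using lim \<open>e > 0\<close> by (auto dest: tendstoD)
  then obtain d0 where "d0 > 0" and d0: "\<And>y. y \<in> E \<Longrightarrow> y \<noteq> p \<Longrightarrow> dist y p < d0 \<Longrightarrow>
      dist (dir_deriv v f y / dir_deriv v g y) L < e"
    unfolding eventually_at by blast
  define d where "d = min d0 r"
  have "d > 0" using \<open>d0 > 0\<close> r_pos by (simp add: d_def)
  \<comment> \<open>A move by at most \<open>\<epsilon>\<close> along \<open>v\<close> has length at
    most \<open>d / 2\<close>; starting within \<open>d / 2\<close> of \<open>p\<close>, it stays in
    the ball of radius \<open>d\<close>. The summand 1 keeps the denominator positive.\<close>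
  define \<epsilon> where "\<epsilon> = d / (2 * (norm v + 1))"
  have "\<epsilon> > 0" using \<open>d > 0\<close> by (simp add: \<epsilon>_def add_nonneg_pos)
  have "\<epsilon> * norm v \<le> \<epsilon> * (norm v + 1)" using \<open>\<epsilon> > 0\<close> by simp
  also have "\<dots> = d / 2" by (simp add: \<epsilon>_def field_simps add_nonneg_eq_0_iff)
  finally have eps_v: "\<epsilon> * norm v \<le> d / 2" .
  have "\<forall>\<^sub>F x in nhds p. x \<in> ball p (d / 2)"
    using \<open>d > 0\<close> by (intro eventually_nhds_in_open) auto
  with eventually_line_meets_C[OF H \<open>\<epsilon> > 0\<close>]
  have "\<forall>\<^sub>F x in nhds p. x \<in> E \<and> g x \<noteq> 0 \<longrightarrow> dist (f x / g x) L < e"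
  proof eventually_elim
    case (elim x)
    show ?case
    proof
      assume x: "x \<in> E \<and> g x \<noteq> 0"
      obtain s where s: "\<bar>s\<bar> \<le> \<epsilon>" "x + s *\<^sub>R v \<in> C" using elim by blast
      \<comment> \<open>\<open>u\<close> points from \<open>x\<close> towards the point of
        \<open>C\<close>. Replacing \<open>v\<close> by \<open>- v\<close> changes the sign of both
        directional derivatives, so their quotient is unaffected.\<close>
      define u where "u = (if s \<ge> 0 then v else - v)"
      have hit: "x + \<bar>s\<bar> *\<^sub>R u \<in> C" using s by (simp add: u_def)
      have near: "dist p (x + q *\<^sub>R u) < d" if "0 \<le> q" "q \<le> \<bar>s\<bar>" for q
      proof -
        have "q * norm v \<le> \<epsilon> * norm v" using that s by (intro mult_right_mono) auto
        then have "norm (q *\<^sub>R u) \<le> d / 2" using that eps_v by (simp add: u_def)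
        moreover have "dist p (x + q *\<^sub>R u) \<le> dist p x + norm (q *\<^sub>R u)"
          using dist_triangle[of p "x + q *\<^sub>R u" x] by (simp add: dist_norm)
        ultimately show ?thesis using elim by simp
      qed
      have "x + q *\<^sub>R u \<in> N" if "0 \<le> q" "q \<le> \<bar>s\<bar>" for q
        using near[OF that] ball_subset by (auto simp: d_def)
      then obtain q where q: "0 < q" "q < \<bar>s\<bar>" "x + q *\<^sub>R u \<in> E"
        "f x * dir_deriv u g (x + q *\<^sub>R u) = g x * dir_deriv u f (x + q *\<^sub>R u)"
        using quotient_eq_at_near_point[OF E _ _ hit] x by auto
      define y where "y = x + q *\<^sub>R u"
      have y: "y \<in> E" "y \<in> N - C" "dist y p < d0"
        using q near[of q] in_components_subset[OF E] by (auto simp: y_def d_def dist_commute)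
      \<comment> \<open>The limit hypothesis speaks of a punctured neighbourhood; \<open>y\<close>
        avoids \<open>C\<close>, while \<open>p\<close> lies in it.\<close>
      then have "y \<noteq> p" using p_in_C by auto
      have "f x * dir_deriv v g y = g x * dir_deriv v f y"
        using q(4)[folded y_def] y(2) diff_at[of y]
        by (auto simp: u_def dir_deriv_minus split: if_splits)
      then have "f x / g x = dir_deriv v f y / dir_deriv v g y"
        using x D[OF y(1)] by (simp add: field_simps)
      then show "dist (f x / g x) L < e" using d0 y \<open>y \<noteq> p\<close> by simp
    qed
  qed
  then show ?thesis by (simp add: eventually_nhds_conv_at)
qed

section \<open>Gluing the limits over all components\<close>

lemma lhospital_through_hypersurfaces:
  assumes lim: "\<And>E. E \<in> components (N - C) \<Longrightarrow> p islimpt E"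
    and v: "\<And>E H. E \<in> components (N - C) \<Longrightarrow> H \<in> \<H> \<Longrightarrow> \<phi>' H (v E) \<noteq> 0"
    and D: "\<And>E y. E \<in> components (N - C) \<Longrightarrow> y \<in> E \<Longrightarrow> dir_deriv (v E) g y \<noteq> 0"
    and L: "\<And>E. E \<in> components (N - C) \<Longrightarrow>
      ((\<lambda>x. dir_deriv (v E) f x / dir_deriv (v E) g x) \<longlongrightarrow> L)
        (at p within {x \<in> E. dir_deriv (v E) g x \<noteq> 0})"
  shows "((\<lambda>x. f x / g x) \<longlongrightarrow> L) (at p within {x \<in> N. g x \<noteq> 0})"
proof (rule tendstoI)
  fix e :: real assume "e > 0"
  obtain H where "H \<in> \<H>" using nonempty_H by blast
  \<comment> \<open>Each component comes with its own neighbourhood of \<open>p\<close>; finiteness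
    of the set of components allows these to be intersected.\<close>
  have "\<forall>\<^sub>F x in at p. \<forall>E\<in>components (N - C). x \<in> E \<and> g x \<noteq> 0 \<longrightarrow> dist (f x / g x) L < e"
  proof (intro eventually_ball_finite ballI)
    show "finite (components (N - C))"
      by (rule finite_components[where v = v]) (fact lim v D)+
    fix E assume E: "E \<in> components (N - C)"
    show "\<forall>\<^sub>F x in at p. x \<in> E \<and> g x \<noteq> 0 \<longrightarrow> dist (f x / g x) L < e"
      using D[OF E] by (rule quotient_near_limit_on_component[OF E \<open>H \<in> \<H>\<close> v[OF E \<open>H \<in> \<H>\<close>] _ L[OF E] \<open>e > 0\<close>])
  qed
  then have "\<forall>\<^sub>F x in at p. x \<in> {x \<in> N. g x \<noteq> 0} \<longrightarrow> dist (f x / g x) L < e"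
  proof eventually_elim
    case (elim x)
    show ?case
    proof
      assume "x \<in> {x \<in> N. g x \<noteq> 0}"
      then have "x \<in> N - C" "g x \<noteq> 0" by (auto simp: C_eq)
      then have "x \<in> \<Union>(components (N - C))" by (simp only: Union_components)
      then show "dist (f x / g x) L < e" using elim \<open>g x \<noteq> 0\<close> by blast
    qed
  qed
  then show "\<forall>\<^sub>F x in at p within {x \<in> N. g x \<noteq> 0}. dist (f x / g x) L < e"
    by (simp add: eventually_at_filter eventually_mono)
qed

end

section \<open>Reduction of the two cases of the theorem to the local setting\<close>

lemma smooth_on_imp_differentiable:
  assumes "smooth_on U \<phi>"
  shows "\<phi> differentiable_on U"
  using assms[unfolded smooth_on_def, rule_format, of 1] by simp

theorem theorem2p1:
  fixes N C :: "(real ^ 'n) set" and p :: "real ^ 'n"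
    and f g :: "real ^ 'n \<Rightarrow> real"
    and v :: "(real ^ 'n) set \<Rightarrow> real ^ 'n"
    and L :: real
  assumes "CARD('n) \<ge> 2"
    and "open N" and "p \<in> N"
    and "f differentiable_on N" and "g differentiable_on N"
    and "f p = 0" and "g p = 0"
    and "C = {x \<in> N. f x = 0 \<and> g x = 0}"
    and "(smooth_hypersurface C \<and> p \<in> C \<and>
          (\<exists>w. w \<notin> tangent_space C p \<and> (\<forall>x\<in>N. dir_deriv w g x \<noteq> 0) \<and>
               (\<forall>E\<in>components (N - C). v E = w)))
       \<or> (\<exists>\<H>. finite \<H> \<and> card \<H> \<ge> 2 \<and> C = \<Union>\<H> \<and>
               (\<forall>H\<in>\<H>. smooth_hypersurface H \<and> p \<in> H) \<and>
               (\<forall>E\<in>components (N - C).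
                  (\<forall>H\<in>\<H>. v E \<notin> tangent_space H p) \<and>
                  (\<forall>x\<in>E. dir_deriv (v E) g x \<noteq> 0)))"
    and "\<forall>E\<in>components (N - C). p islimpt {x \<in> E. dir_deriv (v E) g x \<noteq> 0}"
    and "p islimpt {x \<in> N. g x \<noteq> 0}"
    and "\<forall>E\<in>components (N - C).
           ((\<lambda>x. dir_deriv (v E) f x / dir_deriv (v E) g x) \<longlongrightarrow> L)
             (at p within {x \<in> E. dir_deriv (v E) g x \<noteq> 0})"
  shows "((\<lambda>x. f x / g x) \<longlongrightarrow> L) (at p within {x \<in> N. g x \<noteq> 0})"
proof -
  obtain \<H> where fin: "finite \<H>" "\<H> \<noteq> {}" and C: "C = \<Union>\<H>"
    and hyp: "\<And>H. H \<in> \<H> \<Longrightarrow> smooth_hypersurface H \<and> p \<in> H"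
    and tang: "\<And>E H. E \<in> components (N - C) \<Longrightarrow> H \<in> \<H> \<Longrightarrow> v E \<notin> tangent_space H p"
    and D: "\<And>E x. E \<in> components (N - C) \<Longrightarrow> x \<in> E \<Longrightarrow> dir_deriv (v E) g x \<noteq> 0"
    using assms(9)
  proof
    assume *: "smooth_hypersurface C \<and> p \<in> C \<and>
      (\<exists>w. w \<notin> tangent_space C p \<and> (\<forall>x\<in>N. dir_deriv w g x \<noteq> 0) \<and>
        (\<forall>E\<in>components (N - C). v E = w))"
    then obtain w where w: "w \<notin> tangent_space C p" "\<And>x. x \<in> N \<Longrightarrow> dir_deriv w g x \<noteq> 0"
        "\<And>E. E \<in> components (N - C) \<Longrightarrow> v E = w"
      by blast
    \<comment> \<open>The first case is treated as the one-element family
      \<open>{C}\<close>.\<close>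
    show thesis
    proof (rule that[of "{C}"])
      show "dir_deriv (v E) g x \<noteq> 0" if "E \<in> components (N - C)" "x \<in> E" for E x
        using w(2)[of x] w(3)[OF that(1)] that in_components_subset[OF that(1)] by auto
    qed (use * w in auto)
  next
    assume "\<exists>\<H>. finite \<H> \<and> card \<H> \<ge> 2 \<and> C = \<Union>\<H> \<and>
      (\<forall>H\<in>\<H>. smooth_hypersurface H \<and> p \<in> H) \<and>
      (\<forall>E\<in>components (N - C). (\<forall>H\<in>\<H>. v E \<notin> tangent_space H p) \<and>
        (\<forall>x\<in>E. dir_deriv (v E) g x \<noteq> 0))"
    then obtain \<H> where *: "finite \<H> \<and> card \<H> \<ge> 2 \<and> C = \<Union>\<H> \<and>
      (\<forall>H\<in>\<H>. smooth_hypersurface H \<and> p \<in> H) \<and>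
      (\<forall>E\<in>components (N - C). (\<forall>H\<in>\<H>. v E \<notin> tangent_space H p) \<and>
        (\<forall>x\<in>E. dir_deriv (v E) g x \<noteq> 0))" ..
    show thesis by (rule that[of \<H>]) (use * in auto)
  qed
  have "\<forall>H\<in>\<H>. \<exists>U \<phi>. local_defining_function H p U \<phi>"
    using hyp unfolding smooth_hypersurface_def by blast
  then obtain U \<phi> where ldf: "\<And>H. H \<in> \<H> \<Longrightarrow> local_defining_function H p (U H) (\<phi> H)"
    by metis
  have U: "open (U H)" "p \<in> U H" "\<phi> H differentiable_on U H" "H \<inter> U H = {y \<in> U H. \<phi> H y = 0}"
    if "H \<in> \<H>" for H
    using ldf[OF that] unfolding local_defining_function_def by (auto intro: smooth_on_imp_differentiable)
  \<comment> \<open>Finitely many domains of defining functions have an open intersection, which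
    provides one radius \<open>r\<close> for all of them.\<close>
  have "open (N \<inter> (\<Inter>H\<in>\<H>. U H))"
    using fin U(1) assms(2) by (intro open_Int open_INT) auto
  moreover have "p \<in> N \<inter> (\<Inter>H\<in>\<H>. U H)"
    using U(2) assms(3) by auto
  ultimately obtain r where r: "r > 0" "ball p r \<subseteq> N \<inter> (\<Inter>H\<in>\<H>. U H)"
    using open_contains_ball by blast
  define \<phi>' where "\<phi>' H = frechet_derivative (\<phi> H) (at p)" for H
  interpret hypersurfaces_through_point N C p f g \<H> \<phi> \<phi>' r
  proof
    show "y \<in> C \<longleftrightarrow> (\<exists>H\<in>\<H>. \<phi> H y = 0)" if "y \<in> ball p r" for y
      using that r U(4) unfolding C by blast
    fix H assume H: "H \<in> \<H>"
    show "continuous_on (ball p r) (\<phi> H)"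
      using differentiable_imp_continuous_on[OF U(3)[OF H]] r H by (blast intro: continuous_on_subset)
    show "(\<phi> H has_derivative \<phi>' H) (at p)"
      using U[OF H] unfolding \<phi>'_def
      by (simp add: differentiable_on_eq_differentiable_at flip: frechet_derivative_works)
    show "\<phi> H p = 0" using U[OF H] hyp[OF H] by blast
  qed (use assms r fin in auto)
  show ?thesis
  proof (rule lhospital_through_hypersurfaces[where v = v])
    fix E assume E: "E \<in> components (N - C)"
    show "p islimpt E" using assms(10) E by (auto elim: islimpt_subset)
    show "((\<lambda>x. dir_deriv (v E) f x / dir_deriv (v E) g x) \<longlongrightarrow> L)
        (at p within {x \<in> E. dir_deriv (v E) g x \<noteq> 0})"
      using assms(12) E by blast
    \<comment> \<open>\<open>tangent_space\<close> is defined by an existential over local defining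
      functions, so a vector outside it is outside the kernel for each of them, in particular for
      the chosen \<open>\<phi> H\<close>.\<close>
    show "\<phi>' H (v E) \<noteq> 0" if "H \<in> \<H>" for H
      using tang[OF E that] ldf[OF that] unfolding tangent_space_def \<phi>'_def by blast
  qed (use D in auto)
qed

end
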